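(* Let $G$ be a $g$-expectation and let $V=(V_t)_{0\le t\le T}$ be a $g$-supermartingale (resp. $g$-submartingale) with respect to $G$. Then there exists a unique (up to $P$-a.s. equality) predictable increasing (resp. decreasing) process $K=(K_t)_{0\le t\le T}$ with $K_0=0$ such that $V+K$ is a $g$-martingale.
   Context: Setting: $T$ is a positive integer, $m\ge 1$, and $X=(X_t)_{0\le t\le T}$ is a stochastic process with values in the set of standard basis vectors of $\mathbb{R}^m$ on a probability space $(\Omega,\mathcal{F},P)$; $\mathcal{F}_t$ is the completion of $\sigma(X_0,\dots,X_t)$ and $\mathcal{F}=\mathcal{F}_T$. Increasing/decreasing are meant in the weak sense. A $g$-expectation (equivalently, a filtration consistent, translation invariant nonlinear expectation) is a system of operators $G(\cdot|\mathcal{F}_t):L^1(\mathcal{F}_T;\mathbb{R})\to L^1(\mathcal{F}_t;\mathbb{R})$, $0\le t\le T$, such that for all $\xi,\xi'\in L^1(\mathcal{F}_T;\mathbb{R})$ and all $t$: (i) if $\xi\ge\xi'$ $P$-a.s. then $G(\xi|\mathcal{F}_t)\ge G(\xi'|\mathcal{F}_t)$ $P$-a.s.; (ii) $G(\xi|\mathcal{F}_t)=\xi$ for every $\mathcal{F}_t$-measurable $\xi$; (iii) $G(G(\xi|\mathcal{F}_t)|\mathcal{F}_s)=G(\xi|\mathcal{F}_s)$ for all $s<t$; (iv) $I_A G(\xi|\mathcal{F}_t)=G(I_A\xi|\mathcal{F}_t)$ for every $A\in\mathcal{F}_t$; (v) $G(\xi+q|\mathcal{F}_t)=G(\xi|\mathcal{F}_t)+q$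 for every $q\in L^1(\mathcal{F}_t;\mathbb{R})$. A process $V$ is a $g$-supermartingale if $V_t\in L^1(\mathcal{F}_t;\mathbb{R})$ for all $t$ and $V_s\ge G(V_t|\mathcal{F}_s)$ $P$-a.s. for all $s\le t$; a $g$-submartingale if instead $V_s\le G(V_t|\mathcal{F}_s)$; a $g$-martingale if equality holds. A process $K$ is predictable if $K_{t+1}$ is $\mathcal{F}_t$-measurable for all $0\le t<T$. *)

theory Defs
  imports "HOL-Probability.Probability"
begin

text \<open>The completion is that of the measure space obtained by restricting \<^term>\<open>M\<close> to
  \<open>\<sigma>(X\<^sub>0, \<dots>, X\<^sub>t)\<close>.\<close>

definition completed_filtration ::
    "'a measure \<Rightarrow> (nat \<Rightarrow> 'a \<Rightarrow> 'b::topological_space) \<Rightarrow> nat \<Rightarrow> 'a measure" where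
  "completed_filtration M X t =
     completion (restr_to_subalg M
       (sigma (space M) {X s -` B \<inter> space M | s B. s \<le> t \<and> B \<in> sets borel}))"

text \<open>Elements of \<open>L\<^sup>1\<close> are represented by functions; equality in \<open>L\<^sup>1\<close> is almost sure equality.\<close>

definition L1 :: "'a measure \<Rightarrow> 'a measure \<Rightarrow> ('a \<Rightarrow> real) set" where
  "L1 M F = {\<xi> \<in> borel_measurable F. integrable M \<xi>}"

text \<open>\<open>G t \<xi>\<close> stands for \<open>G(\<xi> | \<F>\<^sub>t)\<close>, and the index set of all processes is \<open>{0..T}\<close>.
  Compatibility of \<open>G t\<close> with almost sure equality follows from monotonicity.\<close>

definition g_expectation ::
    "'a measure \<Rightarrow> (nat \<Rightarrow> 'a measure) \<Rightarrow> nat \<Rightarrow> (nat \<Rightarrow> ('a \<Rightarrow> real) \<Rightarrow> ('a \<Rightarrow> real)) \<Rightarrow> bool" where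
  "g_expectation M F T G \<longleftrightarrow>
     (\<forall>t\<le>T. \<forall>\<xi>\<in>L1 M (F T). G t \<xi> \<in> L1 M (F t)) \<and>
     (\<forall>t\<le>T. \<forall>\<xi>\<in>L1 M (F T). \<forall>\<xi>'\<in>L1 M (F T).
        (AE \<omega> in M. \<xi> \<omega> \<ge> \<xi>' \<omega>) \<longrightarrow> (AE \<omega> in M. G t \<xi> \<omega> \<ge> G t \<xi>' \<omega>)) \<and>
     (\<forall>t\<le>T. \<forall>\<xi>\<in>L1 M (F T). \<xi> \<in> borel_measurable (F t) \<longrightarrow>
        (AE \<omega> in M. G t \<xi> \<omega> = \<xi> \<omega>)) \<and>
     (\<forall>t\<le>T. \<forall>s<t. \<forall>\<xi>\<in>L1 M (F T).
        AE \<omega> in M. G s (G t \<xi>) \<omega> = G s \<xi> \<omega>) \<and>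
     (\<forall>t\<le>T. \<forall>\<xi>\<in>L1 M (F T). \<forall>A\<in>sets (F t).
        AE \<omega> in M. indicator A \<omega> * G t \<xi> \<omega> = G t (\<lambda>\<omega>. indicator A \<omega> * \<xi> \<omega>) \<omega>) \<and>
     (\<forall>t\<le>T. \<forall>\<xi>\<in>L1 M (F T). \<forall>q\<in>L1 M (F t).
        AE \<omega> in M. G t (\<lambda>\<omega>. \<xi> \<omega> + q \<omega>) \<omega> = G t \<xi> \<omega> + q \<omega>)"

definition g_supermartingale ::
    "'a measure \<Rightarrow> (nat \<Rightarrow> 'a measure) \<Rightarrow> nat \<Rightarrow> (nat \<Rightarrow> ('a \<Rightarrow> real) \<Rightarrow> ('a \<Rightarrow> real)) \<Rightarrow>
      (nat \<Rightarrow> 'a \<Rightarrow> real) \<Rightarrow> bool" where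
  "g_supermartingale M F T G V \<longleftrightarrow>
     (\<forall>t\<le>T. V t \<in> L1 M (F t)) \<and>
     (\<forall>t\<le>T. \<forall>s\<le>t. AE \<omega> in M. V s \<omega> \<ge> G s (V t) \<omega>)"

definition g_submartingale ::
    "'a measure \<Rightarrow> (nat \<Rightarrow> 'a measure) \<Rightarrow> nat \<Rightarrow> (nat \<Rightarrow> ('a \<Rightarrow> real) \<Rightarrow> ('a \<Rightarrow> real)) \<Rightarrow>
      (nat \<Rightarrow> 'a \<Rightarrow> real) \<Rightarrow> bool" where
  "g_submartingale M F T G V \<longleftrightarrow>
     (\<forall>t\<le>T. V t \<in> L1 M (F t)) \<and>
     (\<forall>t\<le>T. \<forall>s\<le>t. AE \<omega> in M. V s \<omega> \<le> G s (V t) \<omega>)"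

definition g_martingale ::
    "'a measure \<Rightarrow> (nat \<Rightarrow> 'a measure) \<Rightarrow> nat \<Rightarrow> (nat \<Rightarrow> ('a \<Rightarrow> real) \<Rightarrow> ('a \<Rightarrow> real)) \<Rightarrow>
      (nat \<Rightarrow> 'a \<Rightarrow> real) \<Rightarrow> bool" where
  "g_martingale M F T G V \<longleftrightarrow>
     (\<forall>t\<le>T. V t \<in> L1 M (F t)) \<and>
     (\<forall>t\<le>T. \<forall>s\<le>t. AE \<omega> in M. V s \<omega> = G s (V t) \<omega>)"

definition predictable :: "(nat \<Rightarrow> 'a measure) \<Rightarrow> nat \<Rightarrow> (nat \<Rightarrow> 'a \<Rightarrow> real) \<Rightarrow> bool" where
  "predictable F T K \<longleftrightarrow> (\<forall>t<T. K (Suc t) \<in> borel_measurable (F t))"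

definition increasing_process :: "'a measure \<Rightarrow> nat \<Rightarrow> (nat \<Rightarrow> 'a \<Rightarrow> real) \<Rightarrow> bool" where
  "increasing_process M T K \<longleftrightarrow> (AE \<omega> in M. \<forall>t\<le>T. \<forall>s\<le>t. K s \<omega> \<le> K t \<omega>)"

definition decreasing_process :: "'a measure \<Rightarrow> nat \<Rightarrow> (nat \<Rightarrow> 'a \<Rightarrow> real) \<Rightarrow> bool" where
  "decreasing_process M T K \<longleftrightarrow> (AE \<omega> in M. \<forall>t\<le>T. \<forall>s\<le>t. K s \<omega> \<ge> K t \<omega>)"

definition ex1_process_AE ::
    "'a measure \<Rightarrow> nat \<Rightarrow> ((nat \<Rightarrow> 'a \<Rightarrow> real) \<Rightarrow> bool) \<Rightarrow> bool" where
  "ex1_process_AE M T Q \<longleftrightarrow>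
     (\<exists>K. Q K) \<and>
     (\<forall>K K'. Q K \<longrightarrow> Q K' \<longrightarrow> (AE \<omega> in M. \<forall>t\<le>T. K t \<omega> = K' t \<omega>))"

end

theory Submission
  imports Defs
begin

text \<open>As in the classical Doob decomposition, translation invariance lets the \<open>\<F>\<^sub>t\<close>-measurable
  variable \<open>K\<^bsub>t+1\<^esub>\<close> be pulled out of \<open>G(V\<^bsub>t+1\<^esub> + K\<^bsub>t+1\<^esub> | \<F>\<^sub>t)\<close>. The martingale
  property of \<open>V + K\<close> over one step is therefore equivalent to
  \<open>K\<^bsub>t+1\<^esub> - K\<^sub>t = V\<^sub>t - G(V\<^bsub>t+1\<^esub> | \<F>\<^sub>t)\<close>, which determines \<open>K\<close>, and the sign of this increment
  decides between the two cases. The tower property extends one step to any number of steps.\<close>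

text \<open>Each completion adds the subsets of its own null sets, so monotonicity needs a
  comparison of null sets. Both restrictions inherit their values from \<open>M\<close>; hence a
  null set of the coarser one stays null in the finer one.\<close>

lemma sets_completion_restr_to_subalg_mono:
  assumes F: "subalgebra M F" and H: "subalgebra M H" and FH: "sets F \<subseteq> sets H"
  shows "sets (completion (restr_to_subalg M F)) \<subseteq> sets (completion (restr_to_subalg M H))"
proof
  fix A assume "A \<in> sets (completion (restr_to_subalg M F))"
  then obtain S N N' where *: "A = S \<union> N" "S \<in> sets F" "N \<subseteq> N'"
      "N' \<in> null_sets (restr_to_subalg M F)"
    by (auto simp: sets_completion sets_restr_to_subalg[OF F])
  from *(4) have "N' \<in> null_sets (restr_to_subalg M H)"
    using FH by (auto simp: null_sets_def sets_restr_to_subalg F H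
        emeasure_restr_to_subalg)
  with * FH show "A \<in> sets (completion (restr_to_subalg M H))"
    by (auto simp: sets_completion sets_restr_to_subalg[OF H])
qed

lemma sets_completed_filtration_mono:
  assumes X: "\<And>t. t \<le> T \<Longrightarrow> X t \<in> borel_measurable M" and "s \<le> t" "t \<le> T"
  shows "sets (completed_filtration M X s) \<subseteq> sets (completed_filtration M X t)"
proof -
  define C where "C = (\<lambda>t. {X s -` B \<inter> space M | s B. s \<le> t \<and> B \<in> sets borel})"
  \<comment> \<open>Measurability of \<open>X\<close> is assumed up to time \<open>T\<close>; up to
    there the generators lie in \<open>sets M\<close> and span a subalgebra to which
    \<open>M\<close> can be restricted.\<close>
  have CM: "C t \<subseteq> sets M" if "t \<le> T" for t
    using X that by (auto simp: C_def intro: measurable_sets)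
  then have CP: "C t \<subseteq> Pow (space M)" if "t \<le> T" for t
    using that sets.sets_into_space by blast
  have sub: "subalgebra M (sigma (space M) (C t))" if "t \<le> T" for t
    using sets.sigma_sets_subset[OF CM[OF that]] CP[OF that] by (simp add: subalgebra_def)
  have "C s \<subseteq> C t"
    unfolding C_def using \<open>s \<le> t\<close> order_trans by blast
  then have "sets (sigma (space M) (C s)) \<subseteq> sets (sigma (space M) (C t))"
    using CP \<open>s \<le> t\<close> \<open>t \<le> T\<close> by (auto intro!: sigma_sets_mono')
  from sets_completion_restr_to_subalg_mono[OF sub sub this] assms(2,3) show ?thesis
    by (simp add: completed_filtration_def C_def)
qed

lemma space_completed_filtration: "space (completed_filtration M X t) = space M"
  by (simp add: completed_filtration_def restr_to_subalg_def space_measure_of_conv)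

lemma L1_add: "f \<in> L1 M N \<Longrightarrow> g \<in> L1 M N \<Longrightarrow> (\<lambda>\<omega>. f \<omega> + g \<omega>) \<in> L1 M N"
  by (auto simp: L1_def)

lemma L1_diff: "f \<in> L1 M N \<Longrightarrow> g \<in> L1 M N \<Longrightarrow> (\<lambda>\<omega>. f \<omega> - g \<omega>) \<in> L1 M N"
  by (auto simp: L1_def)

text \<open>The decomposition is carried out for an increasing family of sigma-algebras on the space
  of \<open>M\<close>; the completed filtration of \<open>X\<close> is the instance used at the
  end.\<close>

locale g_expectation_filtration =
  fixes M :: "'a measure" and F :: "nat \<Rightarrow> 'a measure" and T :: nat
    and G :: "nat \<Rightarrow> ('a \<Rightarrow> real) \<Rightarrow> ('a \<Rightarrow> real)"
  assumes space_F: "\<And>t. t \<le> T \<Longrightarrow> space (F t) = space M"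
    and sets_F_mono: "\<And>s t. s \<le> t \<Longrightarrow> t \<le> T \<Longrightarrow> sets (F s) \<subseteq> sets (F t)"
    and g_exp: "g_expectation M F T G"
begin

lemma measurable_F_mono:
  "s \<le> t \<Longrightarrow> t \<le> T \<Longrightarrow> f \<in> borel_measurable (F s) \<Longrightarrow> f \<in> borel_measurable (F t)"
  by (rule measurable_from_subalg[of "F t" "F s"]) (simp_all add: subalgebra_def space_F sets_F_mono)

lemma L1_mono: "s \<le> t \<Longrightarrow> t \<le> T \<Longrightarrow> f \<in> L1 M (F s) \<Longrightarrow> f \<in> L1 M (F t)"
  by (auto simp: L1_def intro: measurable_F_mono)

lemma G_L1: "t \<le> T \<Longrightarrow> \<xi> \<in> L1 M (F T) \<Longrightarrow> G t \<xi> \<in> L1 M (F t)"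
  using g_exp[unfolded g_expectation_def, THEN conjunct1] by simp

text \<open>Monotonicity applied in both directions. Elements of L1 are functions here, so this is
  what permits replacing the argument of \<open>G t\<close> by an almost surely equal one.\<close>

lemma G_cong:
  assumes "t \<le> T" "\<xi> \<in> L1 M (F T)" "\<xi>' \<in> L1 M (F T)" "AE \<omega> in M. \<xi> \<omega> = \<xi>' \<omega>"
  shows "AE \<omega> in M. G t \<xi> \<omega> = G t \<xi>' \<omega>"
proof -
  have mono: "AE \<omega> in M. G t \<eta> \<omega> \<ge> G t \<eta>' \<omega>"
    if "\<eta> \<in> L1 M (F T)" "\<eta>' \<in> L1 M (F T)" "AE \<omega> in M. \<eta> \<omega> \<ge> \<eta>' \<omega>" for \<eta> \<eta>'
    using g_exp[unfolded g_expectation_def, THEN conjunct2, THEN conjunct1] that assms(1) by simp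
  have "AE \<omega> in M. \<xi> \<omega> \<ge> \<xi>' \<omega>" "AE \<omega> in M. \<xi>' \<omega> \<ge> \<xi> \<omega>"
    using assms(4) by auto
  from mono[OF assms(2,3) this(1)] mono[OF assms(3,2) this(2)] show ?thesis
    by eventually_elim simp
qed

lemma G_measurable: "t \<le> T \<Longrightarrow> \<xi> \<in> L1 M (F t) \<Longrightarrow> AE \<omega> in M. G t \<xi> \<omega> = \<xi> \<omega>"
  using g_exp[unfolded g_expectation_def, THEN conjunct2, THEN conjunct2, THEN conjunct1]
    L1_mono[of t T \<xi>] by (simp add: L1_def)

lemma G_tower: "s < t \<Longrightarrow> t \<le> T \<Longrightarrow> \<xi> \<in> L1 M (F T) \<Longrightarrow> AE \<omega> in M. G s (G t \<xi>) \<omega> = G s \<xi> \<omega>"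
  using g_exp[unfolded g_expectation_def, THEN conjunct2, THEN conjunct2, THEN conjunct2, THEN conjunct1]
  by simp

lemma G_translation:
  "t \<le> T \<Longrightarrow> \<xi> \<in> L1 M (F T) \<Longrightarrow> q \<in> L1 M (F t) \<Longrightarrow>
    AE \<omega> in M. G t (\<lambda>\<omega>. \<xi> \<omega> + q \<omega>) \<omega> = G t \<xi> \<omega> + q \<omega>"
  using g_exp[unfolded g_expectation_def, THEN conjunct2, THEN conjunct2, THEN conjunct2, THEN conjunct2, THEN conjunct2]
  by simp

text \<open>Induction on the later time along the chain
  \<open>Y s = G s (Y t) = G s (G t (Y (Suc t))) = G s (Y (Suc t))\<close>, each equality holding
  almost surely.\<close>

lemma g_martingaleI:
  assumes L1: "\<And>t. t \<le> T \<Longrightarrow> Y t \<in> L1 M (F t)"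
    and step: "\<And>t. t < T \<Longrightarrow> AE \<omega> in M. Y t \<omega> = G t (Y (Suc t)) \<omega>"
  shows "g_martingale M F T G Y"
proof -
  have "AE \<omega> in M. Y s \<omega> = G s (Y t) \<omega>" if "s \<le> t" "t \<le> T" for s t
    using that
  proof (induction t rule: dec_induct)
    case base
    then show ?case using G_measurable[OF _ L1, of s] by auto
  next
    case (step t)
    have Y: "Y (Suc t) \<in> L1 M (F T)" "Y t \<in> L1 M (F T)"
      using L1 L1_mono step.prems by (meson Suc_leD order_refl)+
    have one: "AE \<omega> in M. Y t \<omega> = G t (Y (Suc t)) \<omega>"
      using assms(2) step.prems by simp
    show ?case
    \<comment> \<open>The tower property is available for \<open>s < t\<close>; for
      \<open>s = t\<close> the claim is the one-step hypothesis itself.\<close>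
    proof (cases "s = t")
      case False
      then have "s < t" using step.hyps by simp
      have "AE \<omega> in M. G s (Y t) \<omega> = G s (G t (Y (Suc t))) \<omega>"
        using Y one step \<open>s < t\<close> by (intro G_cong L1_mono[OF _ _ G_L1]) auto
      moreover have "AE \<omega> in M. G s (G t (Y (Suc t))) \<omega> = G s (Y (Suc t)) \<omega>"
        using Y step.prems \<open>s < t\<close> by (intro G_tower) auto
      moreover have "AE \<omega> in M. Y s \<omega> = G s (Y t) \<omega>"
        using step.IH step.prems by simp
      ultimately show ?thesis by eventually_elim simp
    qed (use one in simp)
  qed
  then show ?thesis using L1 by (auto simp: g_martingale_def)
qed

text \<open>The solution, started at 0, of the recurrence forced by the one-step martingale
  property. The last summand has index \<open>t - 1\<close>, so the value at time \<open>t\<close>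
  is known one step earlier.\<close>

definition compensator :: "(nat \<Rightarrow> 'a \<Rightarrow> real) \<Rightarrow> nat \<Rightarrow> 'a \<Rightarrow> real" where
  "compensator V t \<omega> = (\<Sum>s<t. V s \<omega> - G s (V (Suc s)) \<omega>)"

lemma compensator_0 [simp]: "compensator V 0 \<omega> = 0"
  by (simp add: compensator_def)

lemma compensator_Suc:
  "compensator V (Suc t) \<omega> = compensator V t \<omega> + (V t \<omega> - G t (V (Suc t)) \<omega>)"
  by (simp add: compensator_def)

context
  fixes V :: "nat \<Rightarrow> 'a \<Rightarrow> real"
  assumes V: "\<And>t. t \<le> T \<Longrightarrow> V t \<in> L1 M (F t)"
begin

lemma V_L1_T: "t \<le> T \<Longrightarrow> V t \<in> L1 M (F T)"
  using V L1_mono by blast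

text \<open>The index \<open>t\<close> on the right, one less than the time of the process,
  expresses predictability; with integrability included, the compensator qualifies as the
  translation \<open>q\<close> in \<open>G_translation\<close>.\<close>

lemma compensator_Suc_L1: "t < T \<Longrightarrow> compensator V (Suc t) \<in> L1 M (F t)"
proof (induction t)
  case 0
  then show ?case
    using L1_diff[OF V[of 0] G_L1[OF _ V_L1_T[of 1]]]
    by (simp add: compensator_def)
next
  case (Suc t)
  then have "compensator V (Suc t) \<in> L1 M (F (Suc t))"
    by (intro L1_mono[of t "Suc t"]) auto
  from L1_add[OF this L1_diff[OF V G_L1[OF _ V_L1_T]], of "Suc (Suc t)"] show ?case
    unfolding compensator_Suc[of V "Suc t", abs_def] using Suc.prems by simp
qed

lemma compensator_L1: "t \<le> T \<Longrightarrow> compensator V t \<in> L1 M (F t)"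
proof (cases t)
  case 0
  then show ?thesis by (simp add: compensator_def[abs_def] L1_def)
next
  case (Suc u)
  then show "t \<le> T \<Longrightarrow> ?thesis"
    using L1_mono[OF _ _ compensator_Suc_L1[of u], of t] by simp
qed

lemma predictable_compensator: "predictable F T (compensator V)"
  using compensator_Suc_L1 by (simp add: predictable_def L1_def)

lemma g_martingale_compensator: "g_martingale M F T G (\<lambda>t \<omega>. V t \<omega> + compensator V t \<omega>)"
proof (rule g_martingaleI)
  fix t assume "t < T"
  \<comment> \<open>Translation turns the right-hand side into
    \<open>G t (V (Suc t)) + compensator V (Suc t)\<close>, and the recurrence cancels the first
    term.\<close>
  then show "AE \<omega> in M. V t \<omega> + compensator V t \<omega> =
      G t (\<lambda>\<omega>. V (Suc t) \<omega> + compensator V (Suc t) \<omega>) \<omega>"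
    using G_translation[OF _ V_L1_T compensator_Suc_L1, of t "Suc t"]
    by (auto simp: compensator_Suc)
qed (intro L1_add V compensator_L1)

lemma compensator_unique:
  assumes pred: "predictable F T K" and K0: "AE \<omega> in M. K 0 \<omega> = 0"
    and mart: "g_martingale M F T G (\<lambda>t \<omega>. V t \<omega> + K t \<omega>)"
  shows "AE \<omega> in M. \<forall>t\<le>T. K t \<omega> = compensator V t \<omega>"
proof -
  have "AE \<omega> in M. K t \<omega> = compensator V t \<omega>" if "t \<le> T" for t
    using that
  proof (induction t)
    case 0
    then show ?case using K0 by simp
  next
    case (Suc t)
    \<comment> \<open>Predictability gives measurability of \<open>K (Suc t)\<close> but not
      integrability. The latter is recovered by writing \<open>K (Suc t)\<close> as the difference
      of the martingale and \<open>V\<close>, both integrable.\<close>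
    have "(\<lambda>\<omega>. (V (Suc t) \<omega> + K (Suc t) \<omega>) - V (Suc t) \<omega>) \<in> L1 M (F (Suc t))"
      using mart Suc.prems by (intro L1_diff V) (auto simp: g_martingale_def)
    then have "K (Suc t) \<in> L1 M (F t)"
      using pred Suc.prems by (simp add: L1_def predictable_def)
    then have "AE \<omega> in M. G t (\<lambda>\<omega>. V (Suc t) \<omega> + K (Suc t) \<omega>) \<omega> =
        G t (V (Suc t)) \<omega> + K (Suc t) \<omega>"
      using Suc.prems by (intro G_translation V_L1_T) auto
    moreover have "AE \<omega> in M. V t \<omega> + K t \<omega> = G t (\<lambda>\<omega>. V (Suc t) \<omega> + K (Suc t) \<omega>) \<omega>"
      using mart[unfolded g_martingale_def, THEN conjunct2, rule_format, of "Suc t" t] Suc.prems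
      by simp
    moreover have "AE \<omega> in M. K t \<omega> = compensator V t \<omega>"
      using Suc by simp
    ultimately show ?case
      by eventually_elim (simp add: compensator_Suc)
  qed
  then show ?thesis by (simp add: AE_all_countable)
qed

text \<open>\<open>Q\<close> stands for the sign condition, increasing or decreasing, so that both
  halves of the theorem share one argument.\<close>

lemma ex1_compensator:
  assumes "Q (compensator V)"
  shows "ex1_process_AE M T (\<lambda>K. predictable F T K \<and> Q K \<and>
    (AE \<omega> in M. K 0 \<omega> = 0) \<and> g_martingale M F T G (\<lambda>t \<omega>. V t \<omega> + K t \<omega>))"
  unfolding ex1_process_AE_def
proof (intro conjI allI impI; (elim conjE)?)
  show "\<exists>K. predictable F T K \<and> Q K \<and> (AE \<omega> in M. K 0 \<omega> = 0) \<and>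
      g_martingale M F T G (\<lambda>t \<omega>. V t \<omega> + K t \<omega>)"
    using predictable_compensator assms g_martingale_compensator
    by (intro exI[of _ "compensator V"]) simp
next
  fix K K'
  assume "predictable F T K" "AE \<omega> in M. K 0 \<omega> = 0" "g_martingale M F T G (\<lambda>t \<omega>. V t \<omega> + K t \<omega>)"
    and "predictable F T K'" "AE \<omega> in M. K' 0 \<omega> = 0" "g_martingale M F T G (\<lambda>t \<omega>. V t \<omega> + K' t \<omega>)"
  from compensator_unique[OF this(1-3)] compensator_unique[OF this(4-6)]
  show "AE \<omega> in M. \<forall>t\<le>T. K t \<omega> = K' t \<omega>"
    by eventually_elim simp
qed

end

lemma increasing_compensator:
  assumes "g_supermartingale M F T G V"
  shows "increasing_process M T (compensator V)"
proof -
  have "AE \<omega> in M. G t (V (Suc t)) \<omega> \<le> V t \<omega>" if "t < T" for t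
    using assms that by (auto simp: g_supermartingale_def)
  \<comment> \<open>Finitely many exceptional null sets are merged into one, since
    \<open>increasing_process\<close> compares all times outside a single null set.\<close>
  then have "AE \<omega> in M. \<forall>t<T. G t (V (Suc t)) \<omega> \<le> V t \<omega>"
    by (simp add: AE_all_countable)
  then show ?thesis
    unfolding increasing_process_def compensator_def
    by eventually_elim (auto intro!: sum_mono2)
qed

lemma decreasing_compensator:
  assumes "g_submartingale M F T G V"
  shows "decreasing_process M T (compensator V)"
proof -
  have "AE \<omega> in M. G t (V (Suc t)) \<omega> \<ge> V t \<omega>" if "t < T" for t
    using assms that by (auto simp: g_submartingale_def)
  then have "AE \<omega> in M. \<forall>t<T. G t (V (Suc t)) \<omega> \<ge> V t \<omega>"
    by (simp add: AE_all_countable)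
  then show ?thesis
    unfolding decreasing_process_def
  proof eventually_elim
    case (elim \<omega>)
    have "compensator V t \<omega> \<le> compensator V s \<omega>" if "t \<le> T" "s \<le> t" for s t
    proof -
      \<comment> \<open>The summands are negated because \<open>sum_mono2\<close> requires the added
        terms to be nonnegative.\<close>
      have "(\<Sum>u<s. G u (V (Suc u)) \<omega> - V u \<omega>) \<le> (\<Sum>u<t. G u (V (Suc u)) \<omega> - V u \<omega>)"
        using elim that by (intro sum_mono2) auto
      then show ?thesis by (simp add: compensator_def sum_subtractf)
    qed
    then show ?case by simp
  qed
qed

end

theorem theorem3p5:
  fixes M :: "'a measure"
    and T :: nat
    and X :: "nat \<Rightarrow> 'a \<Rightarrow> real ^ 'm"
    and F :: "nat \<Rightarrow> 'a measure"
    and G :: "nat \<Rightarrow> ('a \<Rightarrow> real) \<Rightarrow> ('a \<Rightarrow> real)"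
    and V :: "nat \<Rightarrow> 'a \<Rightarrow> real"
  assumes "prob_space M"
    and "T > 0"
    and "\<And>t. t \<le> T \<Longrightarrow> X t \<in> borel_measurable M"
    and "\<And>t \<omega>. t \<le> T \<Longrightarrow> \<omega> \<in> space M \<Longrightarrow> X t \<omega> \<in> Basis"
    and "F = completed_filtration M X"
    and "sets M = sets (F T)"
    and "g_expectation M F T G"
  shows "(g_supermartingale M F T G V \<longrightarrow>
            ex1_process_AE M T (\<lambda>K. predictable F T K \<and> increasing_process M T K \<and>
              (AE \<omega> in M. K 0 \<omega> = 0) \<and> g_martingale M F T G (\<lambda>t \<omega>. V t \<omega> + K t \<omega>))) \<and>
         (g_submartingale M F T G V \<longrightarrow>
            ex1_process_AE M T (\<lambda>K. predictable F T K \<and> decreasing_process M T K \<and>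
              (AE \<omega> in M. K 0 \<omega> = 0) \<and> g_martingale M F T G (\<lambda>t \<omega>. V t \<omega> + K t \<omega>)))"
proof -
  interpret g_expectation_filtration M F T G
  proof
    show "sets (F s) \<subseteq> sets (F t)" if "s \<le> t" "t \<le> T" for s t
      unfolding assms(5) using that assms(3) by (intro sets_completed_filtration_mono)
  qed (use assms in \<open>auto simp: space_completed_filtration\<close>)
  show ?thesis
  proof (intro conjI impI)
    assume "g_supermartingale M F T G V"
    then show "ex1_process_AE M T (\<lambda>K. predictable F T K \<and> increasing_process M T K \<and>
        (AE \<omega> in M. K 0 \<omega> = 0) \<and> g_martingale M F T G (\<lambda>t \<omega>. V t \<omega> + K t \<omega>))"
      by (intro ex1_compensator increasing_compensator) (simp_all add: g_supermartingale_def)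
  next
    assume "g_submartingale M F T G V"
    then show "ex1_process_AE M T (\<lambda>K. predictable F T K \<and> decreasing_process M T K \<and>
        (AE \<omega> in M. K 0 \<omega> = 0) \<and> g_martingale M F T G (\<lambda>t \<omega>. V t \<omega> + K t \<omega>))"
      by (intro ex1_compensator decreasing_compensator) (simp_all add: g_submartingale_def)
  qed
qed

end
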